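(* Let $q$ be a prime power and $\xi$ a primitive element of $\mathbb{F}_{q^2}$. Let $d$ be a positive divisor of $q^2-1$, let $n$ be defined by $d=n\cdot\gcd(q+1,d)$, and let $\phi(x)\in\mathbb{F}_{q^2}[x]$. Let $a,b,c\in\mathbb{F}_{q^2}$ and $j\in\mathbb{Z}$ satisfy $ab\neq 0$, $b=\xi^{(q-1)jd/n}a^{q}$ and $ac^{q}=b^{q}c$. Let $u,v\in\mathbb{F}_{q^2}$ and let $r$ be a positive integer such that either $u^{q+1}=v^{q+1}$ and $\gcd(r,(q^2-1)/d)=1$, or $u^{q+1}\neq v^{q+1}$ and $r=1$. Put $A=bu-av$ and $B=au^{q}-bv^{q}$. Then $$f(x)=(ax^{q}+bx+c)^r\,\phi\big((ax^{q}+bx+c)^{(q^2-1)/d}\big)+ux^{q}+vx$$ is a permutation polynomial of $\mathbb{F}_{q^2}$ if and only if $h(x)$ permutes $U_n$, where $$h(x)=x^r\big[B\phi(x)+A^{1-r}B^{qr}\phi(x)^{q}+u^{q+1}-v^{q+1}\big]^{(q^2-1)/d}.$$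
   Context: A polynomial is a permutation polynomial of $\mathbb{F}_{q^2}$ if the map it induces on $\mathbb{F}_{q^2}$ is a bijection. $U_n$ denotes the set of $n$-th roots of unity in $\mathbb{F}_{q^2}$. A polynomial $h$ permutes a subset $T\subseteq\mathbb{F}_{q^2}$ if $y\mapsto h(y)$ restricts to a bijection from $T$ to $T$. Convention: under the hypotheses, if $A=0$ then $B=0$, and in that case the term $A^{1-r}B^{qr}$ is read as $0$. *)

theory Defs
  imports "HOL-Number_Theory.Number_Theory" "HOL-Computational_Algebra.Polynomial"
begin

definition primitive_element :: "'a::finite_field \<Rightarrow> bool" where
  "primitive_element g \<longleftrightarrow> range (\<lambda>k::nat. g ^ k) = UNIV - {0}"

definition unity_roots :: "nat \<Rightarrow> 'a::finite_field set" where
  "unity_roots n = {x. x ^ n = 1}"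

definition poly_permutes :: "'a::finite_field poly \<Rightarrow> 'a set \<Rightarrow> bool" where
  "poly_permutes p T \<longleftrightarrow> bij_betw (poly p) T T"

definition permutation_polynomial :: "'a::finite_field poly \<Rightarrow> bool" where
  "permutation_polynomial p \<longleftrightarrow> bij (poly p)"

end

theory Submission
  imports Defs
begin

text \<open>
  Put \<open>z = b / a\<^sup>q\<close>, so \<open>z\<^bsup>q+1\<^esup> = 1\<close>. The map \<open>L(x) = a x\<^sup>q + b x + c\<close> sends \<open>F\<^bsub>q^2\<^esub>\<close> onto the
  \<open>F\<^sub>q\<close>-line \<open>T\<close> defined by \<open>z y\<^sup>q = y\<close>. With \<open>D = u\<^bsup>q+1\<^esup> - v\<^bsup>q+1\<^esup>\<close>, the affine map
  \<open>M(x) = A x\<^sup>q + B x + D c\<close> satisfies \<open>M (f x) = H (L x)\<close> for \<open>H(y) = y\<^sup>r k(y\<^sup>s)\<close>, where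
  \<open>s = (q\<^sup>2 - 1) / d\<close> and \<open>h(w) = w\<^sup>r k(w)\<^sup>s\<close>; here \<open>B = z A\<^sup>q\<close> on the coefficients and \<open>z y\<^sup>q = y\<close>
  on \<open>T\<close> absorb the \<open>q\<close>-th powers, and \<open>D y = D y\<^sup>r\<close> because \<open>D = 0\<close> or
  \<open>r = 1\<close>. If \<open>A \<noteq> 0\<close>, then \<open>M\<close> also maps onto \<open>T\<close> and \<open>L(x)\<close>, \<open>f(x)\<close>
  determine \<open>x\<close>, so \<open>f\<close> is bijective iff \<open>H\<close> permutes \<open>T\<close>; since \<open>y \<mapsto> y\<^sup>s\<close> maps \<open>T - {0}\<close> onto \<open>U\<^sub>n\<close>
  and \<open>gcd r s = 1\<close>, this holds iff \<open>h\<close> permutes \<open>U\<^sub>n\<close>. If \<open>A = 0\<close>, then \<open>f\<close> factors through the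
  non-injective \<open>L\<close> and \<open>h = 0\<close>, so both sides fail.
\<close>

section \<open>Twisted power maps y^r k(y^s) and their descent along y -> y^s\<close>

lemma power_eq_coprime_imp_eq:
  fixes x y :: "'a::field"
  assumes "coprime r s" "x ^ r = y ^ r" "x ^ s = y ^ s" "y \<noteq> 0"
  shows "x = y"
proof (cases "r = 0")
  case True
  with assms show ?thesis by simp
next
  case False
  from bezout_nat[OF this, of s] assms(1) obtain k l where kl: "r * k = s * l + 1"
    by auto
  define t where "t = x / y"
  have t: "t ^ r = 1" "t ^ s = 1"
    using assms by (simp_all add: t_def power_divide)
  have "t ^ (s * l + 1) = 1"
    by (simp only: flip: kl) (simp add: power_mult t)
  hence "t = 1" by (simp add: power_mult t)
  thus ?thesis using assms(4) by (simp add: t_def)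
qed

text \<open>Since H(y)^s = h(y^s), a permutation of \<open>insert 0 S\<close> that fixes 0 descends
  to a surjection of the finite set \<open>U\<close>. Conversely, injectivity of h recovers y^s from
  H(y), cancelling k(y^s) leaves y^r, and coprimality then gives y.\<close>

lemma inj_on_twisted_power_iff:
  fixes S :: "'a::field set" and k :: "'a \<Rightarrow> 'a"
  assumes "finite S" "0 \<notin> S" "coprime r s" "r > 0" "s > 0"
    and maps: "\<And>y. y \<in> S \<Longrightarrow> y ^ r * k (y ^ s) \<in> insert 0 S"
  defines "U \<equiv> (\<lambda>y. y ^ s) ` S"
  shows "inj_on (\<lambda>y. y ^ r * k (y ^ s)) (insert 0 S) \<longleftrightarrow> bij_betw (\<lambda>w. w ^ r * k w ^ s) U U"
proof -
  define H where "H = (\<lambda>y. y ^ r * k (y ^ s))"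
  define h where "h = (\<lambda>w. w ^ r * k w ^ s)"
  have H0: "H 0 = 0" using \<open>r > 0\<close> by (simp add: H_def)
  have Hh: "H y ^ s = h (y ^ s)" for y
    by (simp add: H_def h_def power_mult_distrib flip: power_mult) (simp add: mult.commute)
  have HS: "H y \<in> insert 0 S" if "y \<in> insert 0 S" for y
    using that maps H0 by (auto simp: H_def)
  have "finite U" using assms by simp
  have "0 \<notin> U" using \<open>0 \<notin> S\<close> by (auto simp: U_def)
  have "inj_on H (insert 0 S) \<longleftrightarrow> bij_betw h U U"
  proof
    assume inj: "inj_on H (insert 0 S)"
    hence "H ` insert 0 S = insert 0 S"
      using HS \<open>finite S\<close> by (intro endo_inj_surj) auto
    have "H ` S = S"
    proof -
      have "H ` insert 0 S = insert 0 (H ` S)" using H0 by simp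
      moreover have "0 \<notin> H ` S"
        using inj \<open>0 \<notin> S\<close> H0 by (auto simp: inj_on_insert)
      ultimately show ?thesis
        using \<open>H ` insert 0 S = insert 0 S\<close> \<open>0 \<notin> S\<close> by (simp add: insert_ident)
    qed
    have "h ` U = (\<lambda>y. H y ^ s) ` S"
      unfolding U_def by (auto simp: Hh)
    also have "\<dots> = (\<lambda>y. y ^ s) ` (H ` S)"
      by (simp add: image_image)
    finally have "h ` U = U"
      using \<open>H ` S = S\<close> by (simp add: U_def)
    thus "bij_betw h U U"
      using \<open>finite U\<close> by (simp add: bij_betw_def eq_card_imp_inj_on)
  next
    assume bij: "bij_betw h U U"
    \<comment> \<open>A zero of \<open>H\<close> on \<open>S\<close> would put 0 into
      h(\<open>U\<close>) = \<open>U\<close>. This is what permits cancelling k(y^s) below.\<close>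
    have kn: "H y \<noteq> 0" if "y \<in> S" for y
    proof
      assume "H y = 0"
      hence "h (y ^ s) = 0" using \<open>s > 0\<close> by (simp flip: Hh)
      moreover have "h (y ^ s) \<in> U" using bij that by (auto simp: bij_betw_def U_def)
      ultimately show False using \<open>0 \<notin> U\<close> by simp
    qed
    have "y = y'" if y: "y \<in> S" "y' \<in> S" and eq: "H y = H y'" for y y'
    proof -
      have "h (y ^ s) = h (y' ^ s)" using Hh eq by metis
      hence s: "y ^ s = y' ^ s"
        using bij y by (auto simp: bij_betw_def U_def inj_on_def)
      hence r: "y ^ r = y' ^ r"
        using eq kn[OF y(2)] by (simp add: H_def)
      have "y' \<noteq> 0" using y(2) \<open>0 \<notin> S\<close> by blast
      with \<open>coprime r s\<close> r s show ?thesis by (rule power_eq_coprime_imp_eq)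
    qed
    hence "inj_on H S" by (rule inj_onI)
    moreover have "0 \<notin> H ` S" using kn by (metis imageE)
    ultimately show "inj_on H (insert 0 S)"
      using H0 by auto
  qed
  thus ?thesis by (simp add: H_def h_def)
qed

text \<open>A form of the Akbary-Ghioca-Wang criterion. Surjectivity of \<open>f\<close> makes
  \<open>H\<close> map \<open>S\<close> onto itself, and finiteness turns this into
  injectivity.\<close>

lemma bij_iff_inj_on_of_commuting_square:
  fixes f :: "'a::finite \<Rightarrow> 'a"
  assumes square: "\<And>x. M (f x) = H (L x)"
    and L: "range L = S" and M: "range M = S"
    and separate: "\<And>x x'. L x = L x' \<Longrightarrow> f x = f x' \<Longrightarrow> x = x'"
  shows "bij f \<longleftrightarrow> inj_on H S"
proof
  assume "bij f"
  have "finite S" by (simp flip: L)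
  have "H ` S = M ` f ` UNIV"
    by (simp add: image_image square flip: L)
  also have "\<dots> = S"
    using \<open>bij f\<close> M by (simp add: bij_is_surj)
  finally show "inj_on H S"
    using \<open>finite S\<close> by (simp add: eq_card_imp_inj_on)
next
  assume "inj_on H S"
  have "inj f"
  proof (rule injI)
    fix x x' assume eq: "f x = f x'"
    hence "H (L x) = H (L x')" by (metis square)
    hence "L x = L x'" using \<open>inj_on H S\<close> L by (auto simp: inj_on_def)
    thus "x = x'" using eq separate by blast
  qed
  thus "bij f" by (simp add: bij_def finite_UNIV_inj_surj)
qed

text \<open>If z^(q+1) = 1 in the field of q^2 elements, these are the fixed points of the
  semilinear involution y -> z y^q; z = 1 gives the subfield of q elements.\<close>

definition twisted_line :: "nat \<Rightarrow> 'a::field \<Rightarrow> 'a set" where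
  "twisted_line q z = {y. z * y ^ q = y}"

section \<open>Frobenius and discrete logarithms in the field of q^2 elements\<close>

locale quadratic_extension =
  fixes q :: nat and g :: "'a::finite_field"
  assumes primepow_q: "primepow q"
    and card_UNIV: "card (UNIV :: 'a set) = q ^ 2"
    and primitive: "primitive_element g"
begin

lemma q_gt_1: "q > 1"
  using primepow_q by (rule primepow_gt_Suc_0[unfolded One_nat_def[symmetric]])

lemma card_units_pos: "q ^ 2 - 1 > 0"
  using q_gt_1 by (simp add: power2_eq_square one_less_mult)

lemma int_card_units: "int (q ^ 2 - 1) = (int q - 1) * (int q + 1)"
  using q_gt_1 by (simp add: of_nat_diff power2_eq_square algebra_simps)

lemma q_CHAR_power: "\<exists>k. q = CHAR('a) ^ k"
proof -
  obtain p k where p: "prime p" "q = p ^ k"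
    using primepow_q by (auto simp: primepow_def)
  have "prime CHAR('a)" by (simp add: prime_CHAR_semidom)
  moreover have "CHAR('a) dvd p ^ (k * 2)"
    using CHAR_dvd_CARD[where 'a = 'a] by (simp add: card_UNIV p power_mult)
  ultimately have "CHAR('a) = p"
    using p(1) prime_dvd_power primes_dvd_imp_eq by blast
  thus ?thesis using p by blast
qed

lemma frob_add: "(x + y :: 'a) ^ q = x ^ q + y ^ q"
  using q_CHAR_power freshmans_dream'[where 'a = 'a] by (metis prime_CHAR_semidom finite_imp_CHAR_pos finite)

lemma frob_diff: "(x - y :: 'a) ^ q = x ^ q - y ^ q"
  using frob_add[of "x - y" y] by simp

lemma frob_frob: "((x :: 'a) ^ q) ^ q = x"
  using finite_field_power_card_eq_same[of x]
  by (simp add: card_UNIV power2_eq_square power_mult)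

text \<open>Otherwise a polynomial of degree q would have q^2 roots. It supplies a nonzero trace and
  shows that a twisted line is not the whole field.\<close>

lemma exists_additive_nonzero:
  assumes "\<alpha> \<noteq> (0 :: 'a)"
  shows "\<exists>x. \<alpha> * x ^ q + \<beta> * x \<noteq> 0"
proof (rule ccontr)
  assume *: "\<nexists>x. \<alpha> * x ^ q + \<beta> * x \<noteq> 0"
  define p where "p = monom \<alpha> q + monom \<beta> 1"
  have "degree (monom \<beta> 1) < degree (monom \<alpha> q)"
    using assms q_gt_1 by (simp add: degree_monom_eq degree_monom_le[THEN le_less_trans])
  hence deg: "degree p = q"
    using assms by (simp add: p_def degree_add_eq_left degree_monom_eq)
  hence "p \<noteq> 0" using q_gt_1 by auto
  have "{x. poly p x = 0} = UNIV"
    using * by (auto simp: p_def poly_monom)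
  hence "q ^ 2 \<le> q"
    using card_poly_roots_bound[OF \<open>p \<noteq> 0\<close>] deg card_UNIV by simp
  thus False using q_gt_1 by (simp add: power2_eq_square)
qed

lemma g_nonzero: "g \<noteq> 0"
  using primitive unfolding primitive_element_def by (metis DiffD2 insertI1 power_one_right rangeI)

lemma exists_power_int:
  assumes "y \<noteq> (0 :: 'a)"
  obtains m :: int where "y = g powi m"
  using assms primitive unfolding primitive_element_def
  by (metis DiffI UNIV_I emptyE imageE insertE power_int_of_nat)

text \<open>The powers with exponent below q^2 - 1 already exhaust the q^2 - 1 nonzero elements, so
  they are distinct and \<open>g\<close> has exactly this order.\<close>

lemma power_int_eq_1_iff: "g powi m = 1 \<longleftrightarrow> int (q ^ 2 - 1) dvd m"
proof -
  define N where "N = q ^ 2 - 1"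
  have N: "N > 0" using card_units_pos by (simp add: N_def)
  have "Suc N = q ^ 2" using q_gt_1 by (simp add: N_def)
  hence "g * g ^ N = g * 1"
    using finite_field_power_card_eq_same[of g] by (simp add: card_UNIV flip: power_Suc)
  hence gN: "g ^ N = 1" using g_nonzero by simp
  have red: "g ^ k = g ^ (k mod N)" for k
  proof -
    have "g ^ k = g ^ (N * (k div N) + k mod N)" by simp
    thus ?thesis by (simp only: power_add power_mult gN power_one mult_1)
  qed
  have "(\<lambda>k. g ^ k) ` {..<N} = range (\<lambda>k. g ^ k)"
  proof (intro equalityI subsetI)
    fix x assume "x \<in> range (\<lambda>k. g ^ k)"
    then obtain k where "x = g ^ (k mod N)" using red by auto
    thus "x \<in> (\<lambda>k. g ^ k) ` {..<N}" using N by auto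
  qed auto
  also have "\<dots> = UNIV - {0}"
    using primitive by (simp add: primitive_element_def)
  finally have "card ((\<lambda>k. g ^ k) ` {..<N}) = N"
    by (simp add: card_UNIV N_def card_Diff_singleton)
  hence inj: "inj_on (\<lambda>k. g ^ k) {..<N}"
    by (intro eq_card_imp_inj_on) auto
  have "g powi m = g powi (m mod int N)"
  proof -
    have "g powi m = g powi (int N * (m div int N) + m mod int N)" by simp
    also have "\<dots> = g powi (m mod int N)"
      using g_nonzero by (subst power_int_add) (simp_all add: power_int_mult gN)
    finally show ?thesis .
  qed
  also have "\<dots> = g ^ nat (m mod int N)"
    using N by (simp add: power_int_nonneg_exp)
  also have "\<dots> = 1 \<longleftrightarrow> nat (m mod int N) = 0"
    using inj_onD[OF inj, of "nat (m mod int N)" 0] N by (auto simp: nat_less_iff)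
  also have "\<dots> \<longleftrightarrow> int N dvd m"
    using N by (auto simp: dvd_eq_mod_eq_0 intro: antisym)
  finally show ?thesis by (simp add: N_def)
qed

section \<open>Twisted lines as ranges of affine maps, and their images under powers\<close>

lemma twisted_line_power:
  assumes "z ^ (q + 1) = 1" "y \<in> twisted_line q z"
  shows "y ^ q = z ^ q * (y :: 'a)"
proof -
  have "z ^ q * y = z ^ q * (z * y ^ q)"
    using assms(2) by (simp only: twisted_line_def mem_Collect_eq)
  also have "\<dots> = z ^ (q + 1) * y ^ q" by simp
  finally show ?thesis by (simp only: assms(1) mult_1)
qed

text \<open>The involution y -> z y^q swaps the two terms in x and fixes c, so all values lie on the
  line. The lemma serves both affine maps, with \<alpha> = a and with \<alpha> = A.\<close>

lemma range_twisted_line: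
  assumes z: "z ^ (q + 1) = 1" and \<alpha>: "\<alpha> \<noteq> (0 :: 'a)" and c: "c \<in> twisted_line q z"
  shows "range (\<lambda>x. \<alpha> * x ^ q + z * \<alpha> ^ q * x + c) = twisted_line q z"
proof (intro equalityI subsetI)
  fix y assume "y \<in> range (\<lambda>x. \<alpha> * x ^ q + z * \<alpha> ^ q * x + c)"
  then obtain x where y: "y = \<alpha> * x ^ q + z * \<alpha> ^ q * x + c" by auto
  have zq: "z * z ^ q = 1" using z by simp
  have "z * y ^ q = z * \<alpha> ^ q * x + (z * z ^ q) * (\<alpha> * x ^ q) + z * c ^ q"
    by (simp add: y frob_add power_mult_distrib frob_frob algebra_simps)
  thus "y \<in> twisted_line q z"
    using c zq by (simp add: twisted_line_def y)
next
  fix y assume y: "y \<in> twisted_line q z"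
  have z0: "z \<noteq> 0" using z by auto
  have zq: "z * z ^ q = 1" using z by simp
  \<comment> \<open>Dividing by a nonzero value of the trace \<open>x \<mapsto> x\<^sup>q + x\<close> produces a preimage of \<open>y\<close>.\<close>
  obtain x where x: "1 * x ^ q + 1 * x \<noteq> (0 :: 'a)"
    using exists_additive_nonzero[of 1 1] by auto
  define \<tau> where "\<tau> = x ^ q + x"
  have \<tau>: "\<tau> \<noteq> 0" "\<tau> ^ q = \<tau>"
    using x by (simp_all add: \<tau>_def frob_add frob_frob)
  define y' where "y' = y - c"
  have y': "z * y' ^ q = y'"
    using y c by (simp add: y'_def twisted_line_def frob_diff algebra_simps)
  \<comment> \<open>Solves z \<alpha>^q t = x y' / \<tau>. The conjugate term \<alpha> t^q is then
    x^q y' / \<tau>, and the two add up to y'.\<close>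
  define t where "t = x * y' / (\<tau> * z * \<alpha> ^ q)"
  have "\<alpha> * t ^ q = \<alpha> * (x ^ q * y' ^ q) / (\<tau> * z ^ q * \<alpha>)"
    by (simp add: t_def power_divide power_mult_distrib \<tau> frob_frob)
  also have "\<dots> = x ^ q * y' / \<tau>"
    using \<alpha> z0 \<tau> zq y' by (simp add: divide_simps) (metis mult.commute mult.left_commute mult.right_neutral)
  finally have "\<alpha> * t ^ q + z * \<alpha> ^ q * t + c = (x ^ q + x) * y' / \<tau> + c"
    using z0 \<alpha> by (simp add: t_def algebra_simps add_divide_distrib)
  also have "\<dots> = y" using \<tau> by (simp add: \<tau>_def y'_def)
  finally have "y = \<alpha> * t ^ q + z * \<alpha> ^ q * t + c" ..
  thus "y \<in> range (\<lambda>x. \<alpha> * x ^ q + z * \<alpha> ^ q * x + c)"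
    by (rule range_eqI)
qed

text \<open>In exponents of \<open>g\<close>, both memberships become divisibility conditions.
  Surjectivity then reduces to a linear congruence modulo n, solvable because (q+1)/gcd(q+1,d) is
  coprime to n.\<close>

lemma twisted_line_power_image:
  assumes "d > 0" "d dvd q ^ 2 - 1" and n: "d = n * gcd (q + 1) d"
  defines "s \<equiv> (q ^ 2 - 1) div d"
  shows "(\<lambda>y. y ^ s) ` (twisted_line q (g powi ((int q - 1) * j * int (d div n))) - {0}) = unity_roots n"
proof -
  define e where "e = gcd (q + 1) d"
  have e: "d div n = e" "d = n * e" "e > 0" "n > 0"
    using n \<open>d > 0\<close> unfolding e_def[symmetric] by (auto intro: Nat.gr0I)
  define Q where "Q = (q + 1) div e"
  have Q: "q + 1 = Q * e" by (simp add: Q_def e_def)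
  have "coprime Q n"
  proof -
    have "gcd (e * Q) (e * n) = e" using Q e(2) by (metis e_def mult.commute)
    hence "e * gcd Q n = e" by (metis gcd_mult_distrib_nat)
    hence "gcd Q n = 1" using e(3) by simp
    thus ?thesis by (rule gcd_eq_1_imp_coprime)
  qed
  have "q ^ 2 - 1 = s * d" using assms(2) by (simp add: s_def)
  hence s: "q ^ 2 - 1 = s * n * e" "s > 0"
    using card_units_pos e(2) by (auto intro: Nat.gr0I)
  have line: "g powi m \<in> twisted_line q (g powi ((int q - 1) * j * int e)) \<longleftrightarrow> int q + 1 dvd j * int e + m" for m
  proof -
    have "g powi ((int q - 1) * j * int e) * (g powi m) ^ q = g powi ((int q - 1) * (j * int e + m)) * g powi m"
      using g_nonzero by (simp add: power_int_power' algebra_simps flip: power_int_add)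
    hence "g powi m \<in> twisted_line q (g powi ((int q - 1) * j * int e))
        \<longleftrightarrow> g powi ((int q - 1) * (j * int e + m)) = 1"
      using g_nonzero by (simp add: twisted_line_def)
    also have "\<dots> \<longleftrightarrow> int q + 1 dvd j * int e + m"
      unfolding power_int_eq_1_iff int_card_units using q_gt_1 by simp
    finally show ?thesis .
  qed
  have root: "g powi m \<in> unity_roots n \<longleftrightarrow> int (s * e) dvd m" for m
  proof -
    have "g powi m \<in> unity_roots n \<longleftrightarrow> int (s * e) * int n dvd m * int n"
      by (simp only: unity_roots_def mem_Collect_eq power_int_power' power_int_eq_1_iff s(1)
          of_nat_mult mult_ac)
    also have "\<dots> \<longleftrightarrow> int (s * e) dvd m"
      using e(4) by (subst dvd_times_right_cancel_iff) auto
    finally show ?thesis .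
  qed
  have intQ: "int q + 1 = int Q * int e"
    using Q by (metis of_nat_1 of_nat_add of_nat_mult)
  show ?thesis
    unfolding e(1)
  proof (intro equalityI subsetI)
    fix w assume "w \<in> (\<lambda>y. y ^ s) ` (twisted_line q (g powi ((int q - 1) * j * int e)) - {0})"
    then obtain m where m: "w = (g powi m) ^ s" "g powi m \<in> twisted_line q (g powi ((int q - 1) * j * int e))"
      by (auto elim: exists_power_int)
    have "int e dvd j * int e + m"
      using m(2) unfolding line intQ by (rule dvd_mult_right)
    hence "int e dvd m" by (simp add: dvd_add_right_iff)
    thus "w \<in> unity_roots n"
      by (simp add: m(1) power_int_power' root mult.commute[of m] mult_dvd_mono)
  next
    fix w :: 'a assume w: "w \<in> unity_roots n"
    hence "w \<noteq> 0" using e(4) by (auto simp: unity_roots_def power_0_left)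
    then obtain m where m: "w = g powi m" by (rule exists_power_int)
    with w root obtain m' where m': "m = int (s * e) * m'" by auto
    \<comment> \<open>Every exponent Q e k - j e gives a point of the line. Its s-th power has
      exponent s e (Q k - j), which must agree with s e m' modulo q^2 - 1 = s n e.\<close>
    obtain k where k: "[int Q * k = m' + j] (mod int n)"
      using \<open>coprime Q n\<close> cong_solve_coprime_int[of "int Q" "int n"]
      by (metis cong_scalar_right coprime_int_iff mult.assoc mult_1)
    define y where "y = g powi (int Q * int e * k - j * int e)"
    have "y \<in> twisted_line q (g powi ((int q - 1) * j * int e))"
      unfolding y_def line by (simp add: intQ)
    moreover have "y \<noteq> 0" using g_nonzero by (simp add: y_def)
    moreover have "y ^ s = w"
    proof -
      obtain l where "int Q * k = m' + j + int n * l"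
        using k by (metis cong_iff_lin cong_sym)
      hence "(int Q * k) * (int e * int s) - j * int e * int s = m + int (q ^ 2 - 1) * l"
        unfolding m' s(1) by (simp add: algebra_simps)
      hence "(int Q * int e * k - j * int e) * int s = m + int (q ^ 2 - 1) * l"
        by (simp add: algebra_simps)
      hence "y ^ s = g powi m * g powi (int (q ^ 2 - 1) * l)"
        using g_nonzero by (simp add: y_def power_int_power' power_int_add)
      also have "g powi (int (q ^ 2 - 1) * l) = 1"
        by (subst power_int_eq_1_iff) simp
      finally show ?thesis by (simp add: m)
    qed
    ultimately show "w \<in> (\<lambda>y. y ^ s) ` (twisted_line q (g powi ((int q - 1) * j * int e)) - {0})"
      by auto
  qed
qed

end

section \<open>The permutation criterion for f in terms of h\<close>

theorem theorem2:
  fixes q d n r :: nat and j :: int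
    and \<xi> a b c u v A B :: "'a::finite_field"
    and \<phi> L f h :: "'a poly"
  assumes "primepow q"
    and "card (UNIV :: 'a set) = q ^ 2"
    and "primitive_element \<xi>"
    and "d > 0" and "d dvd q ^ 2 - 1"
    and "d = n * gcd (q + 1) d"
    and "a * b \<noteq> 0"
    and "b = \<xi> powi ((int q - 1) * j * int (d div n)) * a ^ q"
    and "a * c ^ q = b ^ q * c"
    and "r > 0"
    and "(u ^ (q + 1) = v ^ (q + 1) \<and> gcd r ((q ^ 2 - 1) div d) = 1) \<or>
         (u ^ (q + 1) \<noteq> v ^ (q + 1) \<and> r = 1)"
    and "A = b * u - a * v"
    and "B = a * u ^ q - b * v ^ q"
    and "L = monom a q + monom b 1 + [:c:]"
    and "f = L ^ r * pcompose \<phi> (L ^ ((q ^ 2 - 1) div d)) + monom u q + monom v 1"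
    \<comment> \<open>if \<open>A = 0\<close>, the coefficient \<open>A\<^sup>1\<^sup>-\<^sup>r B\<^sup>q\<^sup>r\<close> is read as 0\<close>
    and "h = monom 1 r *
          (smult B \<phi>
           + smult (if A = 0 then 0 else A powi (1 - int r) * B ^ (q * r)) (\<phi> ^ q)
           + [:u ^ (q + 1) - v ^ (q + 1):]) ^ ((q ^ 2 - 1) div d)"
  shows "permutation_polynomial f \<longleftrightarrow> poly_permutes h (unity_roots n)"
proof -
  interpret quadratic_extension q \<xi>
    by unfold_locales fact+
  define z where "z = \<xi> powi ((int q - 1) * j * int (d div n))"
  define s where "s = (q ^ 2 - 1) div d"
  define D where "D = u ^ (q + 1) - v ^ (q + 1)"
  define T where "T = twisted_line q z"
  have "n > 0" using assms(4,6) by (auto intro: Nat.gr0I)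
  have "s * d = q ^ 2 - 1" using assms(5) by (simp add: s_def)
  hence "s > 0" using card_units_pos by (auto intro: Nat.gr0I)
  have ab: "a \<noteq> 0" "b \<noteq> 0" using assms(7) by auto
  have z: "z ^ (q + 1) = 1"
    unfolding z_def power_int_power' power_int_eq_1_iff
    by (rule dvdI[of _ _ "j * int (d div n)"])
       (simp only: int_card_units of_nat_add of_nat_1 mult_ac)
  hence zz: "z * z ^ q = 1" by simp
  have b: "b = z * a ^ q" using assms(8) by (simp add: z_def)
  have zb: "z * b ^ q = a"
    using zz by (simp add: b power_mult_distrib frob_frob flip: mult.assoc)
  have norm: "b ^ (q + 1) = a ^ (q + 1)"
    using zb by (simp add: b mult.commute mult.left_commute)
  have B: "B = z * A ^ q"
  proof -
    have "z * A ^ q = (z * b ^ q) * u ^ q - (z * a ^ q) * v ^ q"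
      by (simp add: assms(12) frob_diff power_mult_distrib algebra_simps)
    thus ?thesis by (simp add: zb assms(13) flip: b)
  qed
  have c: "c \<in> T"
  proof -
    have "a * (z * c ^ q) = (z * b ^ q) * c" using assms(9) by (simp add: ac_simps)
    thus ?thesis using ab by (simp add: zb T_def twisted_line_def)
  qed
  \<comment> \<open>Norms lie in the subfield of q elements, so scaling by \<open>D\<close>
    preserves the line.\<close>
  have "D ^ q = D"
    by (simp add: D_def frob_diff power_mult_distrib frob_frob mult.commute)
  hence Dc: "D * c \<in> T"
    using c by (simp add: T_def twisted_line_def power_mult_distrib mult.left_commute)
  have L: "poly L x = a * x ^ q + z * a ^ q * x + c" for x
    by (simp add: assms(14) poly_monom flip: b)
  have range_L: "range (poly L) = T"
    using range_twisted_line[OF z ab(1), of c] c by (simp add: L[abs_def] T_def)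
  have f: "poly f x = poly L x ^ r * poly \<phi> (poly L x ^ s) + (u * x ^ q + v * x)" for x
    by (simp add: assms(15) poly_pcompose poly_monom s_def)
  have h: "poly h w = w ^ r * (B * poly \<phi> w
      + (if A = 0 then 0 else A powi (1 - int r) * B ^ (q * r)) * poly \<phi> w ^ q + D) ^ s" for w
    by (simp add: assms(16) poly_monom D_def s_def)
  have image: "(\<lambda>y. y ^ s) ` (T - {0}) = unity_roots n"
    using twisted_line_power_image[OF assms(4-6), of j] by (simp add: T_def z_def s_def)
  have one: "1 \<in> unity_roots n" by (simp add: unity_roots_def)
  have zero: "0 \<notin> unity_roots n" using \<open>n > 0\<close> by (simp add: unity_roots_def power_0_left)
  show ?thesis
  proof (cases "A = 0")
    case True
    hence "B = 0" using B q_gt_1 by simp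
    have bu: "b * u = a * v" using True assms(12) by simp
    hence "b ^ (q + 1) * u ^ (q + 1) = a ^ (q + 1) * v ^ (q + 1)"
      by (metis power_mult_distrib)
    hence "u ^ (q + 1) = v ^ (q + 1)"
      unfolding norm using ab(1) by simp
    hence "poly h 1 = 0"
      using True \<open>B = 0\<close> \<open>s > 0\<close> by (simp add: h D_def)
    hence "\<not> poly_permutes h (unity_roots n)"
      using one zero unfolding poly_permutes_def by (metis bij_betwE)
    moreover have "\<not> inj (poly L)"
    proof
      assume "inj (poly L)"
      hence "T = UNIV" using range_L by (simp add: finite_UNIV_inj_surj)
      moreover have "z \<noteq> 0" using zz by auto
      then obtain x where "z * x ^ q + (- 1) * x \<noteq> 0"
        using exists_additive_nonzero by blast
      ultimately show False unfolding T_def twisted_line_def by auto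
    qed
    moreover have "poly f x = poly f y" if "poly L x = poly L y" for x y
    proof -
      \<comment> \<open>As b u = a v, the pair (u, v) is the multiple u/a of (a, b), so
        \<open>f\<close> depends on x only through \<open>L\<close>.\<close>
      have "u * x ^ q + v * x = u / a * (poly L x - c)" for x
        using bu ab by (simp add: L field_simps flip: b)
      thus ?thesis using that by (simp add: f)
    qed
    hence "inj (poly f) \<Longrightarrow> inj (poly L)" by (meson injD injI)
    ultimately show ?thesis
      by (auto simp: permutation_polynomial_def bij_is_inj)
  next
    case False
    define E where "E = A powi (1 - int r) * B ^ (q * r)"
    define k where "k w = B * poly \<phi> w + E * poly \<phi> w ^ q + D" for w
    define H where "H y = y ^ r * k (y ^ s)" for y
    define M where "M x = A * x ^ q + z * A ^ q * x + D * c" for x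
    have range_M: "range M = T"
      using range_twisted_line[OF z False, of "D * c"] Dc by (simp add: M_def[abs_def] T_def)
    have D_r: "D * y = y ^ r * D" for y
      using assms(11) by (auto simp: D_def)
    \<comment> \<open>This explains the coefficient of \<phi>^q in h: on the line, B^(qr) y^r = A^r
      y^(qr), and the factor A^(1-r) reduces A^r to A.\<close>
    have E: "E * y ^ r = A * (y ^ r) ^ q" if "y \<in> T" for y
    proof -
      have "B ^ q = z ^ q * A" by (simp add: B power_mult_distrib frob_frob)
      hence "E * y ^ r = A powi (1 - int r) * A ^ r * (z ^ q * y) ^ r"
        by (simp add: E_def power_mult power_mult_distrib)
      also have "z ^ q * y = y ^ q"
        using twisted_line_power[OF z, of y] that by (simp add: T_def)
      also have "A powi (1 - int r) * A ^ r = A powi (1 - int r + int r)"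
        using False by (subst power_int_add) auto
      finally show ?thesis by (simp add: mult.commute flip: power_mult)
    qed
    have square: "M (poly f x) = H (poly L x)" for x
    proof -
      define y where "y = poly L x"
      define w where "w = poly \<phi> (y ^ s)"
      have "y \<in> T" using range_L by (auto simp: y_def)
      have M_linear: "M (t + t') = A * t ^ q + B * t + M t'" for t t'
        by (simp add: M_def B frob_add algebra_simps)
      \<comment> \<open>The mixed products cancel and leave D a and D b; the constant D c in
        \<open>M\<close> completes them to D L(x).\<close>
      have "M (u * x ^ q + v * x)
          = (A * v ^ q + B * u) * x ^ q + (A * u ^ q + B * v) * x + D * c"
        by (simp add: M_def frob_add power_mult_distrib frob_frob algebra_simps flip: B)
      also have "A * v ^ q + B * u = D * a"
        by (simp add: assms(12,13) D_def algebra_simps)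
      also have "A * u ^ q + B * v = D * b"
        by (simp add: assms(12,13) D_def algebra_simps)
      finally have "M (u * x ^ q + v * x) = D * y"
        by (simp add: y_def L algebra_simps flip: b)
      hence "M (poly f x) = A * (y ^ r) ^ q * w ^ q + B * (y ^ r * w) + D * y"
        by (simp add: f M_linear power_mult_distrib flip: y_def w_def)
      also have "\<dots> = H y"
        unfolding H_def k_def w_def[symmetric] E[OF \<open>y \<in> T\<close>, symmetric] D_r
        by (simp add: algebra_simps)
      finally show ?thesis by (simp add: y_def)
    qed
    have "bij (poly f) \<longleftrightarrow> inj_on H T"
    proof (rule bij_iff_inj_on_of_commuting_square[where f = "poly f" and L = "poly L" and M = M and H = H])
      fix x x' assume "poly L x = poly L x'" "poly f x = poly f x'"
      hence *: "a * (x ^ q - x' ^ q) + b * (x - x') = 0" "u * (x ^ q - x' ^ q) + v * (x - x') = 0"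
        by (simp_all add: f L algebra_simps flip: b)
      \<comment> \<open>Elimination of x^q - x'^q from the two linear equations; up to sign their
        determinant is A.\<close>
      have "(b * u - a * v) * (x - x') = u * (a * (x ^ q - x' ^ q) + b * (x - x'))
          - a * (u * (x ^ q - x' ^ q) + v * (x - x'))"
        by (simp add: algebra_simps)
      hence "(b * u - a * v) * (x - x') = 0" unfolding * by simp
      thus "x = x'" using False assms(12) by simp
    qed (fact square range_L range_M)+
    also have "T = insert 0 (T - {0})"
      using q_gt_1 by (auto simp: T_def twisted_line_def)
    also have "inj_on H \<dots> \<longleftrightarrow> bij_betw (\<lambda>w. w ^ r * k w ^ s) (unity_roots n) (unity_roots n)"
      unfolding H_def[abs_def] image[symmetric]
    proof (rule inj_on_twisted_power_iff)
      show "coprime r s" using assms(11) by (auto simp: s_def coprime_iff_gcd_eq_1 simp del: coprime_imp_gcd_eq_1)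
      show "y ^ r * k (y ^ s) \<in> insert 0 (T - {0})" if "y \<in> T - {0}" for y
      proof -
        from that range_L obtain x where "y = poly L x" by auto
        hence "H y \<in> T" using square range_M by (metis rangeI)
        thus ?thesis by (auto simp: H_def)
      qed
    qed (use \<open>r > 0\<close> \<open>s > 0\<close> in auto)
    also have "(\<lambda>w. w ^ r * k w ^ s) = poly h"
      using False by (simp add: fun_eq_iff h k_def E_def)
    finally show ?thesis by (simp add: permutation_polynomial_def poly_permutes_def)
  qed
qed

end
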